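(* Let $I\subset\mathbb{R}$ be an interval, let $p\in\mathbb{R}\setminus\{0\}$, let $\alpha\in(0,1)$, let $u:I\to\mathbb{R}$ be hyperbolic $p$-convex on $I$, and let $a,b\in I$ with $a<b$. Let $v:I\to\mathbb{R}$ be a function which on $[a,b]$ is positive, integrable and symmetric (that is, $v(a+b-x)=v(x)$ for $x\in[a,b]$). Then $$u\left(\frac{a+b}{2}\right)\mathcal{C}^2_\alpha(v)\;\leq\;\mathcal{I}^\alpha_{a+}[uv](b)+\mathcal{I}^\alpha_{b-}[uv](a)\;\leq\;\frac{u(a)+u(b)}{2}\cdot\frac{1}{\cosh\left(\frac{p(b-a)}{2}\right)}\,\mathcal{C}^2_\alpha(v),$$ where $$\mathcal{C}^2_{\alpha}(v):=\int_a^b\cosh\left[p\left(x-\frac{a+b}{2}\right)\right]\frac{\exp\left(-\frac{1-\alpha}{\alpha}(b-x)\right)+\exp\left(-\frac{1-\alpha}{\alpha}(x-a)\right)}{\alpha}\,v(x)\,dx.$$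
   Context: A function $f:I\to\mathbb{R}$ is hyperbolic $p$-convex on $I$ if for every closed subinterval $[a,b]\subset I$ (with $a<b$) and all $x\in[a,b]$, $$f(x)\leq \frac{\sinh[p(b-x)]}{\sinh[p(b-a)]}f(a)+\frac{\sinh[p(x-a)]}{\sinh[p(b-a)]}f(b).$$ For $\alpha\in(0,1)$ and $f\in L_1(a,b)$, the fractional integrals with exponential kernel are $\mathcal{I}^\alpha_{a+}[f](x)=\frac1\alpha\int_a^x\exp\left(-\frac{1-\alpha}{\alpha}(x-s)\right)f(s)\,ds$ for $x>a$ and $\mathcal{I}^\alpha_{b-}[f](x)=\frac1\alpha\int_x^b\exp\left(-\frac{1-\alpha}{\alpha}(s-x)\right)f(s)\,ds$ for $x<b$; $uv$ denotes the pointwise product. *)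

theory Defs
  imports "HOL-Analysis.Analysis"
begin

definition hyperbolic_convex_on :: "real \<Rightarrow> real set \<Rightarrow> (real \<Rightarrow> real) \<Rightarrow> bool" where
  "hyperbolic_convex_on p I f \<longleftrightarrow>
     (\<forall>a b. a < b \<and> {a..b} \<subseteq> I \<longrightarrow>
       (\<forall>x\<in>{a..b}.
          f x \<le> sinh (p * (b - x)) / sinh (p * (b - a)) * f a
              + sinh (p * (x - a)) / sinh (p * (b - a)) * f b))"

text \<open>Fractional integrals with exponential kernel. The integrals are Lebesgue integrals; they
  have their intended meaning for \<open>f\<close> Lebesgue integrable on \<open>{a..x}\<close> resp. \<open>{x..b}\<close>
  (otherwise the library integral is \<open>0\<close>).\<close>

definition frac_integral_left :: "real \<Rightarrow> real \<Rightarrow> (real \<Rightarrow> real) \<Rightarrow> real \<Rightarrow> real" where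
  "frac_integral_left \<alpha> a f x =
     1 / \<alpha> * (LINT s:{a..x}|lebesgue. exp (- ((1 - \<alpha>) / \<alpha>) * (x - s)) * f s)"

definition frac_integral_right :: "real \<Rightarrow> real \<Rightarrow> (real \<Rightarrow> real) \<Rightarrow> real \<Rightarrow> real" where
  "frac_integral_right \<alpha> b f x =
     1 / \<alpha> * (LINT s:{x..b}|lebesgue. exp (- ((1 - \<alpha>) / \<alpha>) * (s - x)) * f s)"

definition C2 :: "real \<Rightarrow> real \<Rightarrow> real \<Rightarrow> real \<Rightarrow> (real \<Rightarrow> real) \<Rightarrow> real" where
  "C2 p a b \<alpha> v =
     (LINT x:{a..b}|lebesgue.
        cosh (p * (x - (a + b) / 2))
        * ((exp (- ((1 - \<alpha>) / \<alpha>) * (b - x)) + exp (- ((1 - \<alpha>) / \<alpha>) * (x - a))) / \<alpha>)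
        * v x)"

end

theory Submission
  imports Defs
begin

text \<open>
  The two-sided estimate is a weighted (Fejer type) Hermite--Hadamard inequality. Let \<open>m\<close> be the
  midpoint of \<open>[a, b]\<close>. Hyperbolic convexity bounds the symmetrised function
  \<open>(u x + u (a + b - x)) / 2\<close> on both sides by multiples of \<open>cosh (p * (x - m))\<close>: from below by
  testing the inequality on \<open>[x, a + b - x]\<close> at \<open>m\<close>, from above by adding the inequalities on
  \<open>[a, b]\<close> at \<open>x\<close> and at \<open>a + b - x\<close>. Against a weight that is symmetric about \<open>m\<close>, the function
  \<open>u\<close> has the same integral as its symmetrisation, so integrating these bounds gives
  \<open>hyperbolic_fejer\<close>. The sum of the two fractional integrals is the integral of \<open>u\<close> against \<open>v\<close>
  times the sum of the two exponential kernels; reflection in \<open>m\<close> exchanges the kernels, so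
  this weight is symmetric.

  It remains to see that \<open>u\<close> times an integrable weight is integrable, that is, that \<open>u\<close> is
  measurable and bounded on \<open>[a, b]\<close>. Since \<open>exp (p * x)\<close> times a combination of \<open>exp (p * x)\<close>
  and \<open>exp (- p * x)\<close> is affine in \<open>t = exp (2 * p * x)\<close>, the function \<open>exp (p * x) * u x\<close> is an
  ordinary convex function of \<open>t\<close>. Hence \<open>u\<close> is continuous in the interior of the interval.
  Boundedness follows from the chord inequality on \<open>[a, b]\<close> and the lower bound for the
  symmetrisation.
\<close>

section \<open>Regularity of hyperbolic convex functions\<close>

lemma hyperbolic_convex_onD:
  assumes "hyperbolic_convex_on p I u" "{a..b} \<subseteq> I" "a < b" "x \<in> {a..b}"
  shows "u x \<le> sinh (p * (b - x)) / sinh (p * (b - a)) * u a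
              + sinh (p * (x - a)) / sinh (p * (b - a)) * u b"
  using assms unfolding hyperbolic_convex_on_def by blast

lemma hyperbolic_convex_on_abs:
  "hyperbolic_convex_on \<bar>p\<bar> I u = hyperbolic_convex_on p I u"
  by (simp add: hyperbolic_convex_on_def abs_if)

text \<open>The chord of \<open>u\<close> through \<open>y\<close> and \<open>z\<close> is a combination of \<open>exp (p * x)\<close> and
  \<open>exp (- p * x)\<close>. Multiplied by \<open>exp (p * x)\<close>, which is \<open>sqrt t\<close> for \<open>t = exp (2 * p * x)\<close>, it
  becomes the affine chord in \<open>t\<close>.\<close>

lemma hyperbolic_convex_on_imp_convex_on:
  assumes p: "0 < p" and u: "hyperbolic_convex_on p I u" and sub: "{a..b} \<subseteq> I"
  shows "convex_on {exp (2 * p * a)<..<exp (2 * p * b)} (\<lambda>t. sqrt t * u (ln t / (2 * p)))"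
proof
  fix w r s :: real
  assume w: "0 < w" "w < 1" and r: "r \<in> {exp (2 * p * a)<..<exp (2 * p * b)}"
    and s: "s \<in> {exp (2 * p * a)<..<exp (2 * p * b)}" and rs: "r < s"
  define t where "t = (1 - w) * r + w * s"
  define X where "X = (\<lambda>t. ln t / (2 * p))"
  have r0: "0 < r" using r by (auto intro: less_trans[OF exp_gt_zero])
  have rt: "r < t" and ts: "t < s"
  proof -
    have "t - r = w * (s - r)" "s - t = (1 - w) * (s - r)"
      unfolding t_def by (simp_all add: algebra_simps)
    then show "r < t" "t < s"
      using w rs by (metis diff_gt_0_iff_gt mult_pos_pos)+
  qed
  have t0: "0 < t" and s0: "0 < s" using r0 rt ts by linarith+
  have root: "sqrt q = exp (p * X q)" and sq: "q = exp (p * X q) ^ 2" if "0 < q" for q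
  proof -
    have "exp (p * X q) ^ 2 = exp (2 * (p * X q))" by (simp add: exp_double)
    also have "\<dots> = q" using that p by (simp add: X_def)
    finally show "q = exp (p * X q) ^ 2" by simp
    then show "sqrt q = exp (p * X q)" by (metis exp_ge_zero real_sqrt_unique)
  qed
  have X_less: "X q < X q'" if "0 < q" "q < q'" for q q'
    unfolding X_def using that p by (simp add: divide_strict_right_mono)
  have "a < X r" "X s < b"
    using r s r0 s0 p ln_less_cancel_iff[of "exp (2 * p * a)" r]
      ln_less_cancel_iff[of s "exp (2 * p * b)"]
    unfolding X_def by (auto simp: field_simps)
  then have "{X r..X s} \<subseteq> I" using sub by auto
  then have "u (X t) \<le> sinh (p * (X s - X t)) / sinh (p * (X s - X r)) * u (X r)
              + sinh (p * (X t - X r)) / sinh (p * (X s - X r)) * u (X s)"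
    using u X_less[OF r0 rt] X_less[OF t0 ts] by (intro hyperbolic_convex_onD) auto
  then have "exp (p * X t) * u (X t) \<le> exp (p * X t) *
             (sinh (p * (X s - X t)) / sinh (p * (X s - X r)) * u (X r)
              + sinh (p * (X t - X r)) / sinh (p * (X s - X r)) * u (X s))"
    by (intro mult_left_mono) auto
  also have "\<dots> = (exp (p * X t) * sinh (p * (X s - X t)) / sinh (p * (X s - X r))) * u (X r)
              + (exp (p * X t) * sinh (p * (X t - X r)) / sinh (p * (X s - X r))) * u (X s)"
    by (simp add: algebra_simps)
  \<comment> \<open>In terms of the square roots \<open>R\<close>, \<open>S\<close>, \<open>T\<close> of \<open>r\<close>, \<open>s\<close>, \<open>t\<close> the weights are rational
    functions, and \<open>t = (1 - w) * r + w * s\<close> reduces them to multiples of \<open>R\<close> and \<open>S\<close>.\<close>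
  also have "exp (p * X t) * sinh (p * (X s - X t)) / sinh (p * (X s - X r))
              = (1 - w) * exp (p * X r)"
  proof -
    define R S T where "R = exp (p * X r)" and "S = exp (p * X s)" and "T = exp (p * X t)"
    have pos: "0 < R" "0 < S" "0 < T" by (simp_all add: R_def S_def T_def)
    have S1: "sinh (p * (X s - X t)) = (S / T - T / S) / 2"
      by (simp add: sinh_def right_diff_distrib exp_diff S_def T_def field_simps)
    have S2: "sinh (p * (X s - X r)) = (S / R - R / S) / 2"
      by (simp add: sinh_def right_diff_distrib exp_diff S_def R_def field_simps)
    have T2: "T ^ 2 = (1 - w) * R ^ 2 + w * S ^ 2"
      using sq[OF r0] sq[OF s0] sq[OF t0] t_def by (simp add: R_def S_def T_def)
    have "R ^ 2 < S ^ 2" using sq[OF r0] sq[OF s0] rs by (simp add: R_def S_def)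
    then have ne: "S * S - R * R \<noteq> 0" by (simp add: power2_eq_square)
    have "T * ((S / T - T / S) / 2) = (S ^ 2 - T ^ 2) / (2 * S)"
      using pos by (simp add: field_simps power2_eq_square)
    also have "S ^ 2 - T ^ 2 = (1 - w) * (S ^ 2 - R ^ 2)" by (simp add: T2 algebra_simps)
    also have "(1 - w) * (S ^ 2 - R ^ 2) / (2 * S) = (1 - w) * R * ((S / R - R / S) / 2)"
      using pos by (simp add: field_simps power2_eq_square)
    finally have eq: "T * ((S / T - T / S) / 2) = (1 - w) * R * ((S / R - R / S) / 2)" .
    have "(S / R - R / S) / 2 \<noteq> 0" using pos ne by (simp add: field_simps)
    then have "T * ((S / T - T / S) / 2) / ((S / R - R / S) / 2) = (1 - w) * R"
      unfolding eq by simp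
    then show ?thesis unfolding S1 S2 by (simp add: R_def T_def)
  qed
  also have "exp (p * X t) * sinh (p * (X t - X r)) / sinh (p * (X s - X r))
              = w * exp (p * X s)"
  proof -
    define R S T where "R = exp (p * X r)" and "S = exp (p * X s)" and "T = exp (p * X t)"
    have pos: "0 < R" "0 < S" "0 < T" by (simp_all add: R_def S_def T_def)
    have S1: "sinh (p * (X t - X r)) = (T / R - R / T) / 2"
      by (simp add: sinh_def right_diff_distrib exp_diff R_def T_def field_simps)
    have S2: "sinh (p * (X s - X r)) = (S / R - R / S) / 2"
      by (simp add: sinh_def right_diff_distrib exp_diff S_def R_def field_simps)
    have T2: "T ^ 2 = (1 - w) * R ^ 2 + w * S ^ 2"
      using sq[OF r0] sq[OF s0] sq[OF t0] t_def by (simp add: R_def S_def T_def)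
    have "R ^ 2 < S ^ 2" using sq[OF r0] sq[OF s0] rs by (simp add: R_def S_def)
    then have ne: "S * S - R * R \<noteq> 0" by (simp add: power2_eq_square)
    have "T * ((T / R - R / T) / 2) = (T ^ 2 - R ^ 2) / (2 * R)"
      using pos by (simp add: field_simps power2_eq_square)
    also have "T ^ 2 - R ^ 2 = w * (S ^ 2 - R ^ 2)" by (simp add: T2 algebra_simps)
    also have "w * (S ^ 2 - R ^ 2) / (2 * R) = w * S * ((S / R - R / S) / 2)"
      using pos by (simp add: field_simps power2_eq_square)
    finally have eq: "T * ((T / R - R / T) / 2) = w * S * ((S / R - R / S) / 2)" .
    have "(S / R - R / S) / 2 \<noteq> 0" using pos ne by (simp add: field_simps)
    then have "T * ((T / R - R / T) / 2) / ((S / R - R / S) / 2) = w * S"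
      unfolding eq by simp
    then show ?thesis unfolding S1 S2 by (simp add: S_def T_def)
  qed
  finally show "sqrt ((1 - w) *\<^sub>R r + w *\<^sub>R s) * u (ln ((1 - w) *\<^sub>R r + w *\<^sub>R s) / (2 * p))
      \<le> (1 - w) * (sqrt r * u (ln r / (2 * p))) + w * (sqrt s * u (ln s / (2 * p)))"
    using root[OF r0] root[OF s0] root[OF t0] by (simp add: X_def t_def mult.assoc)
qed (simp add: convex_real_interval)

lemma hyperbolic_convex_on_imp_continuous_on:
  assumes "p \<noteq> 0" "hyperbolic_convex_on p I u" "{a..b} \<subseteq> I"
  shows "continuous_on {a<..<b} u"
proof -
  \<comment> \<open>A positive parameter makes the substitution \<open>t = exp (2 * q * x)\<close> increasing.\<close>
  define q where "q = \<bar>p\<bar>"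
  have q: "0 < q" using assms(1) by (simp add: q_def)
  define g where "g = (\<lambda>t. sqrt t * u (ln t / (2 * q)))"
  have "convex_on {exp (2 * q * a)<..<exp (2 * q * b)} g"
    unfolding g_def using q assms hyperbolic_convex_on_abs[of p I u]
    by (intro hyperbolic_convex_on_imp_convex_on[of q I u]) (simp_all add: q_def)
  then have "continuous_on {exp (2 * q * a)<..<exp (2 * q * b)} g"
    by (intro convex_on_continuous) auto
  then have "continuous_on {a<..<b} (\<lambda>x. g (exp (2 * q * x)))"
  proof (rule continuous_on_compose2)
    show "continuous_on {a<..<b} (\<lambda>x. exp (2 * q * x))" by (intro continuous_intros)
    show "(\<lambda>x. exp (2 * q * x)) ` {a<..<b} \<subseteq> {exp (2 * q * a)<..<exp (2 * q * b)}"
      using q by auto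
  qed
  then have "continuous_on {a<..<b} (\<lambda>x. exp (- (q * x)) * g (exp (2 * q * x)))"
    by (rule continuous_on_mult[rotated]) (intro continuous_intros)
  moreover have "exp (- (q * x)) * g (exp (2 * q * x)) = u x" for x
  proof -
    have "exp (2 * q * x) = exp (q * x) ^ 2"
      by (simp add: exp_double mult.assoc)
    then have "sqrt (exp (2 * q * x)) = exp (q * x)"
      by simp
    then have "g (exp (2 * q * x)) = exp (q * x) * u x" using q by (simp add: g_def)
    then show ?thesis by (simp add: exp_minus)
  qed
  ultimately show ?thesis by simp
qed

text \<open>The values at the two endpoints are unconstrained by continuity, but two points do not
  affect measurability.\<close>

lemma hyperbolic_convex_on_imp_measurable:
  assumes "p \<noteq> 0" "hyperbolic_convex_on p I u" "{a..b} \<subseteq> I"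
  shows "u \<in> borel_measurable (lebesgue_on {a..b})"
proof -
  define h where "h = (\<lambda>x. if x \<in> {a<..<b} then u x else 0)"
  have "h \<in> borel_measurable borel"
    unfolding h_def
    using hyperbolic_convex_on_imp_continuous_on[OF assms]
    by (intro borel_measurable_continuous_on_if) auto
  then have "(\<lambda>x. if x = a then u a else if x = b then u b else h x) \<in> borel_measurable borel"
    by measurable
  then have "(\<lambda>x. if x = a then u a else if x = b then u b else h x)
      \<in> borel_measurable (lebesgue_on {a..b})"
    by (intro measurable_restrict_space1 measurable_completion) auto
  then show ?thesis
    by (rule measurable_cong[THEN iffD1, rotated]) (auto simp: h_def)
qed

section \<open>Pointwise bounds for the symmetrised function\<close>

text \<open>On an interval of radius \<open>d\<close> both endpoints have weight
  \<open>sinh (p * d) / sinh (2 * p * d) = 1 / (2 * cosh (p * d))\<close> at the midpoint. For \<open>x\<close> right of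
  the midpoint the roles of \<open>x\<close> and its mirror image are exchanged, and at the midpoint itself
  the interval degenerates.\<close>

lemma hyperbolic_convex_midpoint_le:
  assumes p: "p \<noteq> 0" and u: "hyperbolic_convex_on p I u" and sub: "{a..b} \<subseteq> I"
    and x: "x \<in> {a..b}"
  shows "u ((a + b) / 2) * cosh (p * (x - (a + b) / 2)) \<le> (u x + u (a + b - x)) / 2"
proof -
  have left: "u ((a + b) / 2) * cosh (p * (y - (a + b) / 2)) \<le> (u y + u (a + b - y)) / 2"
    if y: "y \<in> {a..b}" "y < (a + b) / 2" for y
  proof -
    define d where "d = (a + b) / 2 - y"
    have d: "0 < d" using y by (simp add: d_def)
    have s: "sinh (p * d) \<noteq> 0" using p d by simp
    have chord: "u ((a + b) / 2)
        \<le> sinh (p * ((a + b - y) - (a + b) / 2)) / sinh (p * ((a + b - y) - y)) * u y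
          + sinh (p * ((a + b) / 2 - y)) / sinh (p * ((a + b - y) - y)) * u (a + b - y)"
      using y sub by (intro hyperbolic_convex_onD[OF u]) (auto simp: field_simps)
    have arg: "(a + b - y) - (a + b) / 2 = d" "(a + b) / 2 - y = d"
      "p * ((a + b - y) - y) = 2 * (p * d)"
      by (simp_all add: d_def field_simps)
    have weight: "sinh (p * d) / sinh (2 * (p * d)) = 1 / (2 * cosh (p * d))"
      using s by (simp add: sinh_double)
    have "u ((a + b) / 2) \<le> (u y + u (a + b - y)) / (2 * cosh (p * d))"
      using chord unfolding arg weight by (simp add: add_divide_distrib)
    then have "u ((a + b) / 2) * cosh (p * d) \<le> (u y + u (a + b - y)) / 2"
      using cosh_real_pos[of "p * d"] by (simp add: field_simps)
    moreover have "p * (y - (a + b) / 2) = - (p * d)" by (simp add: d_def algebra_simps)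
    ultimately show ?thesis by (simp only: cosh_minus)
  qed
  consider "x < (a + b) / 2" | "x = (a + b) / 2" | "x > (a + b) / 2" by linarith
  then show ?thesis
  proof cases
    case 1
    then show ?thesis using left x by blast
  next
    case 2
    then have reflect: "a + b - x = x" by simp
    show ?thesis unfolding reflect by (simp add: 2)
  next
    case 3
    have "p * ((a + b - x) - (a + b) / 2) = - (p * (x - (a + b) / 2))"
      by (simp add: field_simps)
    then have even: "cosh (p * ((a + b - x) - (a + b) / 2)) = cosh (p * (x - (a + b) / 2))"
      by (metis cosh_minus)
    have "u ((a + b) / 2) * cosh (p * ((a + b - x) - (a + b) / 2))
        \<le> (u (a + b - x) + u (a + b - (a + b - x))) / 2"
      using x 3 by (intro left) auto
    then show ?thesis unfolding even by (simp add: add.commute)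
  qed
qed

text \<open>The two weights at \<open>x\<close> are exchanged by reflection, so both endpoint values receive the
  same total weight, and the addition theorem for \<open>sinh\<close> evaluates it.\<close>

lemma hyperbolic_convex_le_endpoints:
  assumes p: "p \<noteq> 0" and u: "hyperbolic_convex_on p I u" and sub: "{a..b} \<subseteq> I" and ab: "a < b"
    and x: "x \<in> {a..b}"
  shows "(u x + u (a + b - x)) / 2
    \<le> (u a + u b) / 2 * (1 / cosh (p * (b - a) / 2)) * cosh (p * (x - (a + b) / 2))"
proof -
  define k l where "k = p * (b - a) / 2" and "l = p * (x - (a + b) / 2)"
  have arg: "p * (b - x) = k - l" "p * (x - a) = k + l" "p * (b - a) = 2 * k"
    by (simp_all add: k_def l_def field_simps)
  have s: "sinh k \<noteq> 0" using p ab by (simp add: k_def)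
  have "u x \<le> sinh (p * (b - x)) / sinh (p * (b - a)) * u a
              + sinh (p * (x - a)) / sinh (p * (b - a)) * u b"
    using u sub ab x by (rule hyperbolic_convex_onD)
  then have 1: "u x \<le> sinh (k - l) / sinh (2 * k) * u a + sinh (k + l) / sinh (2 * k) * u b"
    unfolding arg .
  have "u (a + b - x) \<le> sinh (p * (b - (a + b - x))) / sinh (p * (b - a)) * u a
              + sinh (p * ((a + b - x) - a)) / sinh (p * (b - a)) * u b"
    using x by (intro hyperbolic_convex_onD[OF u sub ab]) auto
  moreover have "b - (a + b - x) = x - a" "(a + b - x) - a = b - x" by simp_all
  ultimately have
    "u (a + b - x) \<le> sinh (k + l) / sinh (2 * k) * u a + sinh (k - l) / sinh (2 * k) * u b"
    by (simp only: arg)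
  with 1 have "u x + u (a + b - x)
      \<le> (sinh (k - l) + sinh (k + l)) / sinh (2 * k) * (u a + u b)"
    by (simp add: add_divide_distrib algebra_simps)
  also have "(sinh (k - l) + sinh (k + l)) / sinh (2 * k) = cosh l / cosh k"
    unfolding sinh_double using s cosh_real_pos[of k]
    by (simp add: sinh_add sinh_diff field_simps)
  finally show ?thesis unfolding k_def[symmetric] l_def[symmetric] by (simp add: field_simps)
qed

text \<open>A chord bounds \<open>u\<close> from above. The midpoint inequality then bounds \<open>u x\<close> from below, because
  it bounds \<open>u x + u (a + b - x)\<close> from below and \<open>u (a + b - x)\<close> is bounded above.\<close>

lemma hyperbolic_convex_on_imp_bounded:
  assumes p: "p \<noteq> 0" and u: "hyperbolic_convex_on p I u" and sub: "{a..b} \<subseteq> I" and ab: "a < b"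
  shows "bounded (u ` {a..b})"
proof -
  define c where "c = (\<lambda>x. sinh (p * (b - x)) / sinh (p * (b - a)) * u a
              + sinh (p * (x - a)) / sinh (p * (b - a)) * u b)"
  define l where "l = (\<lambda>x. u ((a + b) / 2) * cosh (p * (x - (a + b) / 2)))"
  have "sinh (p * (b - a)) \<noteq> 0" using p ab by simp
  then have "continuous_on {a..b} c" unfolding c_def by (intro continuous_intros) auto
  then have "bounded (c ` {a..b})"
    by (intro compact_imp_bounded compact_continuous_image) auto
  then obtain C where C: "\<And>x. x \<in> {a..b} \<Longrightarrow> \<bar>c x\<bar> \<le> C"
    by (metis bounded_iff image_eqI real_norm_def)
  have "continuous_on {a..b} l" unfolding l_def by (intro continuous_intros)
  then have "bounded (l ` {a..b})"
    by (intro compact_imp_bounded compact_continuous_image) auto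
  then obtain L where L: "\<And>x. x \<in> {a..b} \<Longrightarrow> \<bar>l x\<bar> \<le> L"
    by (metis bounded_iff image_eqI real_norm_def)
  have upper: "u x \<le> C" if "x \<in> {a..b}" for x
    using hyperbolic_convex_onD[OF u sub ab that] C[OF that] by (simp add: c_def)
  have "norm (u x) \<le> C + 2 * L" if x: "x \<in> {a..b}" for x
    using upper[OF x] upper[of "a + b - x"] x L[OF x]
      hyperbolic_convex_midpoint_le[OF p u sub x] by (auto simp: l_def)
  then show ?thesis by (intro boundedI[of _ "C + 2 * L"]) blast
qed

lemma hyperbolic_convex_on_mult_integrable:
  assumes "p \<noteq> 0" "hyperbolic_convex_on p I u" "{a..b} \<subseteq> I" "a < b"
    and "set_integrable lebesgue {a..b} w"
  shows "set_integrable lebesgue {a..b} (\<lambda>x. u x * w x)"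
  using assms hyperbolic_convex_on_imp_measurable hyperbolic_convex_on_imp_bounded
  by (intro absolutely_integrable_bounded_measurable_product_real) auto

lemma continuous_on_mult_integrable:
  fixes f w :: "real \<Rightarrow> real"
  assumes "continuous_on {a..b} f" "set_integrable lebesgue {a..b} w"
  shows "set_integrable lebesgue {a..b} (\<lambda>x. f x * w x)"
  using assms
  by (intro absolutely_integrable_bounded_measurable_product_real
      continuous_imp_measurable_on_sets_lebesgue compact_imp_bounded compact_continuous_image) auto

section \<open>The weighted Hermite--Hadamard inequality\<close>

lemma has_integral_reflect_midpoint:
  fixes f :: "real \<Rightarrow> real"
  assumes "(f has_integral i) {a..b}"
  shows "((\<lambda>x. f (a + b - x)) has_integral i) {a..b}"
proof -
  have "((\<lambda>x. f (- x)) has_integral i) {- b..- a}" using assms by simp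
  from has_integral_shift_real_ivl[OF this, of "- (a + b)"]
  show ?thesis by (simp add: add.commute)
qed

text \<open>Replacing \<open>u\<close> by its symmetrisation leaves the integral against the symmetric weight
  unchanged, so the pointwise bounds for the symmetrisation can be integrated.\<close>

lemma hyperbolic_fejer:
  assumes p: "p \<noteq> 0" and u: "hyperbolic_convex_on p I u" and sub: "{a..b} \<subseteq> I" and ab: "a < b"
    and w: "set_integrable lebesgue {a..b} w"
    and nonneg: "\<And>x. x \<in> {a..b} \<Longrightarrow> 0 \<le> w x"
    and sym: "\<And>x. x \<in> {a..b} \<Longrightarrow> w (a + b - x) = w x"
  defines "C \<equiv> (LINT x:{a..b}|lebesgue. cosh (p * (x - (a + b) / 2)) * w x)"
  shows "u ((a + b) / 2) * C \<le> (LINT x:{a..b}|lebesgue. u x * w x)"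
    and "(LINT x:{a..b}|lebesgue. u x * w x)
      \<le> (u a + u b) / 2 * (1 / cosh (p * (b - a) / 2)) * C"
proof -
  define J where "J = (LINT x:{a..b}|lebesgue. u x * w x)"
  define c where "c = (\<lambda>x. cosh (p * (x - (a + b) / 2)))"
  have J: "((\<lambda>x. u x * w x) has_integral J) {a..b}"
    unfolding J_def
    using hyperbolic_convex_on_mult_integrable[OF p u sub ab w] by (rule has_integral_set_lebesgue)
  from has_integral_reflect_midpoint[OF this]
  have "((\<lambda>x. u (a + b - x) * w x) has_integral J) {a..b}"
    by (rule has_integral_eq[rotated]) (simp add: sym)
  with J have "((\<lambda>x. (u x * w x + u (a + b - x) * w x) / 2) has_integral (J + J) / 2) {a..b}"
    by (intro has_integral_divide has_integral_add)
  then have Jsym: "((\<lambda>x. (u x + u (a + b - x)) / 2 * w x) has_integral J) {a..b}"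
    by (simp add: algebra_simps add_divide_distrib)
  have "set_integrable lebesgue {a..b} (\<lambda>x. c x * w x)"
    unfolding c_def by (intro continuous_on_mult_integrable w continuous_intros)
  then have "((\<lambda>x. c x * w x) has_integral C) {a..b}"
    unfolding C_def c_def by (rule has_integral_set_lebesgue)
  then have Ck: "((\<lambda>x. k * c x * w x) has_integral k * C) {a..b}" for k
    unfolding mult.assoc by (rule has_integral_mult_right)
  show "u ((a + b) / 2) * C \<le> (LINT x:{a..b}|lebesgue. u x * w x)"
    unfolding J_def[symmetric]
    using hyperbolic_convex_midpoint_le[OF p u sub] nonneg
    by (intro has_integral_le[OF Ck Jsym] mult_right_mono) (auto simp: c_def)
  show "(LINT x:{a..b}|lebesgue. u x * w x)
      \<le> (u a + u b) / 2 * (1 / cosh (p * (b - a) / 2)) * C"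
    unfolding J_def[symmetric]
    using hyperbolic_convex_le_endpoints[OF p u sub ab] nonneg
    by (intro has_integral_le[OF Jsym Ck] mult_right_mono) (auto simp: c_def)
qed

theorem theorem2p4:
  fixes I :: "real set" and p \<alpha> a b :: real and u v :: "real \<Rightarrow> real"
  assumes "is_interval I"
    and "p \<noteq> 0"
    and "0 < \<alpha>" and "\<alpha> < 1"
    and "hyperbolic_convex_on p I u"
    and "a \<in> I" and "b \<in> I" and "a < b"
    and "\<And>x. x \<in> {a..b} \<Longrightarrow> 0 < v x"
    and "set_integrable lebesgue {a..b} v"
    and "\<And>x. x \<in> {a..b} \<Longrightarrow> v (a + b - x) = v x"
  shows "u ((a + b) / 2) * C2 p a b \<alpha> v
           \<le> frac_integral_left \<alpha> a (\<lambda>x. u x * v x) b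
             + frac_integral_right \<alpha> b (\<lambda>x. u x * v x) a
       \<and> frac_integral_left \<alpha> a (\<lambda>x. u x * v x) b
             + frac_integral_right \<alpha> b (\<lambda>x. u x * v x) a
           \<le> (u a + u b) / 2 * (1 / cosh (p * (b - a) / 2)) * C2 p a b \<alpha> v"
proof -
  define K where "K = (\<lambda>x. (exp (- ((1 - \<alpha>) / \<alpha>) * (b - x)) + exp (- ((1 - \<alpha>) / \<alpha>) * (x - a))) / \<alpha>)"
  have sub: "{a..b} \<subseteq> I"
    by (intro subsetI mem_is_interval_1_I[OF assms(1,6,7)]) auto
  have w: "set_integrable lebesgue {a..b} (\<lambda>x. K x * v x)"
    unfolding K_def using assms(3,10) by (intro continuous_on_mult_integrable continuous_intros) auto
  have Kpos: "0 \<le> K x" for x unfolding K_def using assms(3) by simp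
  have Ksym: "K (a + b - x) = K x" for x unfolding K_def by (simp add: add.commute)
  have C2_eq: "C2 p a b \<alpha> v = (LINT x:{a..b}|lebesgue. cosh (p * (x - (a + b) / 2)) * (K x * v x))"
    by (simp add: C2_def K_def mult.assoc)
  have uv: "set_integrable lebesgue {a..b} (\<lambda>x. u x * v x)"
    by (rule hyperbolic_convex_on_mult_integrable[OF assms(2,5) sub assms(8,10)])
  have left: "set_integrable lebesgue {a..b} (\<lambda>x. exp (- ((1 - \<alpha>) / \<alpha>) * (b - x)) * (u x * v x))"
    by (rule continuous_on_mult_integrable[OF _ uv]) (intro continuous_intros)
  have right: "set_integrable lebesgue {a..b} (\<lambda>x. exp (- ((1 - \<alpha>) / \<alpha>) * (x - a)) * (u x * v x))"
    by (rule continuous_on_mult_integrable[OF _ uv]) (intro continuous_intros)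
  have "frac_integral_left \<alpha> a (\<lambda>x. u x * v x) b + frac_integral_right \<alpha> b (\<lambda>x. u x * v x) a
    = 1 / \<alpha> * (LINT x:{a..b}|lebesgue. exp (- ((1 - \<alpha>) / \<alpha>) * (b - x)) * (u x * v x)
          + exp (- ((1 - \<alpha>) / \<alpha>) * (x - a)) * (u x * v x))"
    unfolding frac_integral_left_def frac_integral_right_def
    unfolding set_integral_add(2)[OF left right] by (simp add: distrib_left)
  also have "\<dots> = (LINT x:{a..b}|lebesgue. 1 / \<alpha> * (exp (- ((1 - \<alpha>) / \<alpha>) * (b - x)) * (u x * v x)
          + exp (- ((1 - \<alpha>) / \<alpha>) * (x - a)) * (u x * v x)))"
    by (rule set_integral_mult_right[symmetric])
  also have "\<dots> = (LINT x:{a..b}|lebesgue. u x * (K x * v x))"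
    by (rule arg_cong[where f = "set_lebesgue_integral lebesgue {a..b}"])
      (simp add: K_def fun_eq_iff add_divide_distrib algebra_simps)
  finally have sum_eq: "frac_integral_left \<alpha> a (\<lambda>x. u x * v x) b
    + frac_integral_right \<alpha> b (\<lambda>x. u x * v x) a = (LINT x:{a..b}|lebesgue. u x * (K x * v x))" .
  have wpos: "0 \<le> K x * v x" if "x \<in> {a..b}" for x
    using Kpos assms(9)[OF that] by simp
  have wsym: "K (a + b - x) * v (a + b - x) = K x * v x" if "x \<in> {a..b}" for x
    using Ksym assms(11)[OF that] by simp
  show ?thesis
    unfolding C2_eq sum_eq
    by (intro conjI hyperbolic_fejer[OF assms(2,5) sub assms(8) w]) (simp_all only: wpos wsym)
qed

end
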